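(* Let $n\ge6$ be an even integer and $\pi\in S_n$ with $G_\pi$ connected. Then $\gamma(G_\pi)=n/2$ if and only if $G_\pi$ is a comb. Furthermore, there are exactly $2$ permutations $\pi\in S_n$ such that $G_\pi$ is connected and $\gamma(G_\pi)=n/2$.
   Context: For a permutation $\pi$ of $[n]=\{1,\dots,n\}$ (one-line notation $[\pi(1),\dots,\pi(n)]$), the permutation graph $G_\pi$ has vertex set $[n]$ and an edge between $i<j$ iff $\pi^{-1}(i)>\pi^{-1}(j)$. $\gamma(G)$ is the domination number (minimum size of a set $D$ such that every vertex is in $D$ or adjacent to a vertex of $D$). For even $n$, a graph $G$ on $n$ vertices is a comb if $V(G)$ can be partitioned into two sets $V_1,V_2$ of size $n/2$ such that the induced subgraph on $V_1$ is a path, the induced subgraph on $V_2$ has no edges, and the edges between $V_1$ and $V_2$ form a perfect matching. *)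

theory Defs
  imports
    "Graph_Theory.Digraph_Component"
    "HOL-Combinatorics.Permutations"
begin

text \<open>
  A simple undirected graph is represented as a loop-free digraph with a symmetric arc relation:
  an undirected edge between u and v corresponds to the two arcs (u, v) and (v, u).
\<close>

definition permutation_graph :: "nat \<Rightarrow> (nat \<Rightarrow> nat) \<Rightarrow> nat pair_pre_digraph" where
  "permutation_graph n \<pi> =
    \<lparr> pverts = {1..n},
      parcs = {(i, j). i \<in> {1..n} \<and> j \<in> {1..n} \<and>
        (i < j \<and> inv \<pi> i > inv \<pi> j \<or> j < i \<and> inv \<pi> j > inv \<pi> i)} \<rparr>"

lemma pair_graph_permutation_graph: "pair_graph (permutation_graph n \<pi>)"
proof
  show "finite (parcs (permutation_graph n \<pi>))"
    by (rule finite_subset[of _ "{1..n} \<times> {1..n}"]) (auto simp: permutation_graph_def)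
qed (auto simp: permutation_graph_def symmetric_def arcs_ends_def arc_to_ends_def with_proj_def
    intro!: symI)

definition dominating_set :: "('a, 'b) pre_digraph \<Rightarrow> 'a set \<Rightarrow> bool" where
  "dominating_set G D \<longleftrightarrow>
    D \<subseteq> verts G \<and> (\<forall>v\<in>verts G. v \<in> D \<or> (\<exists>d\<in>D. v \<rightarrow>\<^bsub>G\<^esub> d))"

text \<open>Only meaningful for graphs with finitely many vertices.\<close>

definition domination_number :: "('a, 'b) pre_digraph \<Rightarrow> nat" where
  "domination_number G = Min (card ` {D. dominating_set G D})"

text \<open>A path graph has at least one vertex.\<close>

definition path_graph :: "('a, 'b) pre_digraph \<Rightarrow> bool" where
  "path_graph G \<longleftrightarrow>
    (\<exists>vs. vs \<noteq> [] \<and> distinct vs \<and> set vs = verts G \<and>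
      (\<forall>i<length vs. \<forall>j<length vs. vs ! i \<rightarrow>\<^bsub>G\<^esub> vs ! j \<longleftrightarrow> (j = Suc i \<or> i = Suc j)))"

definition edges_between :: "('a, 'b) pre_digraph \<Rightarrow> 'a set \<Rightarrow> 'a set \<Rightarrow> 'a set set" where
  "edges_between G U W = {{u, w} |u w. u \<in> U \<and> w \<in> W \<and> u \<rightarrow>\<^bsub>G\<^esub> w}"

definition perfect_matching :: "('a, 'b) pre_digraph \<Rightarrow> 'a set set \<Rightarrow> bool" where
  "perfect_matching G M \<longleftrightarrow>
    M \<subseteq> {{u, w} |u w. u \<rightarrow>\<^bsub>G\<^esub> w} \<and> (\<forall>v\<in>verts G. \<exists>!e. e \<in> M \<and> v \<in> e)"

definition comb :: "('a, 'b) pre_digraph \<Rightarrow> bool" where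
  "comb G \<longleftrightarrow> even (card (verts G)) \<and>
    (\<exists>V\<^sub>1 V\<^sub>2. V\<^sub>1 \<union> V\<^sub>2 = verts G \<and> V\<^sub>1 \<inter> V\<^sub>2 = {} \<and>
      card V\<^sub>1 = card (verts G) div 2 \<and> card V\<^sub>2 = card (verts G) div 2 \<and>
      path_graph (G \<restriction> V\<^sub>1) \<and> arcs (G \<restriction> V\<^sub>2) = {} \<and>
      perfect_matching G (edges_between G V\<^sub>1 V\<^sub>2))"

end

theory Submission
  imports Defs "HOL-Library.Infinite_Set"
begin

text \<open>
  In a connected permutation graph on \<open>n = 2m\<close> vertices the left-to-right maxima and the
  right-to-left minima are disjoint dominating sets. If the domination number is \<open>m\<close>, each of them
  has exactly \<open>m\<close> elements and together they exhaust the vertices, so the graph is bipartite with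
  parts \<open>u\<^sub>1 < \<dots> < u\<^sub>m\<close> and \<open>l\<^sub>1 < \<dots> < l\<^sub>m\<close>, and adjacency is closed under uncrossing.
  Exhibiting dominating sets of size \<open>m - 1\<close> shows first that \<open>u\<^sub>i\<close> and \<open>l\<^sub>i\<close> are adjacent, then that
  one vertex of each pair is a leaf. Connectedness makes the kind of the leaf alternate with \<open>i\<close>.
  Hence the adjacencies, and therefore all ranks and \<open>\<pi>\<close> itself, are determined by whether \<open>u\<^sub>1\<close> or
  \<open>l\<^sub>1\<close> is the leaf.
\<close>

subsection \<open>Crossing-closed relations\<close>

text \<open>\<open>A i j\<close> stands for the adjacency of the \<open>i\<close>-th left-to-right maximum and the \<open>j\<close>-th right-to-left
  minimum.\<close>

locale crossing_relation =
  fixes m :: nat and A :: "nat \<Rightarrow> nat \<Rightarrow> bool"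
  assumes cross: "\<lbrakk>i \<in> {1..m}; j \<in> {1..m}; i' \<in> {1..m}; j' \<in> {1..m}; i \<le> i'; j' \<le> j; A i j; A i' j'\<rbrakk>
      \<Longrightarrow> A i j' \<and> A i' j"
    and row: "i \<in> {1..m} \<Longrightarrow> \<exists>j\<in>{1..m}. A i j"
    and col: "j \<in> {1..m} \<Longrightarrow> \<exists>i\<in>{1..m}. A i j"
    and linked: "\<lbrakk>1 \<le> k; k < m\<rbrakk>
      \<Longrightarrow> \<exists>i\<in>{1..m}. \<exists>j\<in>{1..m}. A i j \<and> (i \<le> k \<and> k < j \<or> j \<le> k \<and> k < i)"
    and dominating_card: "\<lbrakk>X \<subseteq> {1..m}; Y \<subseteq> {1..m};
        \<And>i. i \<in> {1..m} \<Longrightarrow> i \<in> X \<or> (\<exists>j\<in>Y. A i j);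
        \<And>j. j \<in> {1..m} \<Longrightarrow> j \<in> Y \<or> (\<exists>i\<in>X. A i j)\<rbrakk> \<Longrightarrow> m \<le> card X + card Y"
begin

text \<open>The assumptions are symmetric in the two kinds of vertices, so facts about rows carry
  over to columns.\<close>

lemma transpose: "crossing_relation m (\<lambda>i j. A j i)"
proof
  fix i j i' j' assume *: "i \<in> {1..m}" "j \<in> {1..m}" "i' \<in> {1..m}" "j' \<in> {1..m}" "i \<le> i'" "j' \<le> j"
    "A j i" "A j' i'"
  show "A j' i \<and> A j i'" using cross[of j' i' j i] * by blast
next
  fix X Y assume *: "X \<subseteq> {1..m}" "Y \<subseteq> {1..m}"
    "\<And>i. i \<in> {1..m} \<Longrightarrow> i \<in> X \<or> (\<exists>j\<in>Y. A j i)"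
    "\<And>j. j \<in> {1..m} \<Longrightarrow> j \<in> Y \<or> (\<exists>i\<in>X. A j i)"
  show "m \<le> card X + card Y" using dominating_card[of Y X] * by (simp add: add.commute)
next
  fix k assume "1 \<le> k" "k < m"
  then show "\<exists>i\<in>{1..m}. \<exists>j\<in>{1..m}. A j i \<and> (i \<le> k \<and> k < j \<or> j \<le> k \<and> k < i)"
    using linked[of k] by blast
qed (use row col in auto)

text \<open>Otherwise the rows after \<^term>\<open>i\<close> and the columns before \<^term>\<open>i\<close> would dominate.\<close>

lemma above_diagonal:
  assumes i: "i \<in> {1..m}"
  shows "\<exists>j\<in>{i..m}. A i j"
proof (rule ccontr)
  assume no: "\<not> ?thesis"
  obtain j0 where j0: "j0 \<in> {1..m}" "A i j0" using row[OF i] by blast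
  have j0i: "j0 < i" using no j0 by (meson atLeastAtMost_iff not_le)
  have "m \<le> card {i<..m} + card {1..<i}"
  proof (rule dominating_card)
    fix r assume r: "r \<in> {1..m}"
    show "r \<in> {i<..m} \<or> (\<exists>j\<in>{1..<i}. A r j)"
    proof (cases "r \<le> i")
      case True
      obtain j where j: "j \<in> {1..m}" "A r j" using row[OF r] by blast
      \<comment> \<open>Uncrossing the entries \<open>(r, j)\<close> and \<open>(i, j0)\<close>
        moves row \<open>r\<close> from a column \<open>j \<ge> i\<close> to
        \<open>j0 < i\<close>.\<close>
      have "A r j0" if "i \<le> j"
        using cross[of r j i j0] r j i j0 True that j0i by simp
      then have "\<exists>j\<in>{1..<i}. A r j" using j j0 j0i
        by (metis atLeastAtMost_iff atLeastLessThan_iff not_le)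
      then show ?thesis ..
    qed (use r in auto)
  next
    fix c assume c: "c \<in> {1..m}"
    show "c \<in> {1..<i} \<or> (\<exists>i\<in>{i<..m}. A i c)"
    proof (cases "c < i")
      case False
      obtain r where r: "r \<in> {1..m}" "A r c" using col[OF c] by blast
      \<comment> \<open>If \<open>r \<le> i\<close>, uncrossing with \<open>(i, j0)\<close> would
        give row \<open>i\<close> an entry in column \<open>c \<ge> i\<close>, against
        \<open>no\<close>.\<close>
      have "i < r"
      proof (rule ccontr)
        assume "\<not> i < r"
        then have "A i c" using cross[of r c i j0] r c i j0 False j0i by simp
        then show False using no c False by auto
      qed
      then show ?thesis using r by auto
    qed (use c in auto)
  qed (use i in auto)
  then show False using i by auto
qed

text \<open>\<open>above_diagonal\<close>, for the relation and for its transpose, gives an entry in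
  row \<open>i\<close> and one in column \<open>i\<close>, neither before \<open>(i, i)\<close>;
  uncrossing them yields \<open>(i, i)\<close>.\<close>

lemma diagonal:
  assumes i: "i \<in> {1..m}"
  shows "A i i"
proof -
  obtain j where "j \<in> {i..m}" "A i j" using above_diagonal[OF i] by blast
  moreover obtain r where "r \<in> {i..m}" "A r i"
    using crossing_relation.above_diagonal[OF transpose i] by blast
  ultimately show ?thesis using cross[of i j r i] i by auto
qed

text \<open>Uncross the given entry with the diagonal entry \<open>(t, t)\<close>.\<close>

lemma convex:
  assumes "i \<in> {1..m}" "j \<in> {1..m}" "A i j" "i \<le> t \<and> t \<le> j \<or> j \<le> t \<and> t \<le> i"
  shows "A i t \<and> A t j"
proof -
  have t: "t \<in> {1..m}" using assms by auto
  show ?thesis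
    using assms(4) cross[OF assms(1,2) t t _ _ assms(3) diagonal[OF t]]
      cross[OF t t assms(1,2) _ _ diagonal[OF t] assms(3)] by blast
qed

text \<open>\<open>linked\<close> supplies an edge across the cut after \<open>k\<close>, and
  \<open>convex\<close> shortens it until it joins the pairs \<open>k\<close> and
  \<open>Suc k\<close>.\<close>

lemma consecutive:
  assumes k: "1 \<le> k" "k < m"
  shows "A k (Suc k) \<or> A (Suc k) k"
proof -
  obtain i j where ij: "i \<in> {1..m}" "j \<in> {1..m}" "A i j" "i \<le> k \<and> k < j \<or> j \<le> k \<and> k < i"
    using linked[OF k] by blast
  show ?thesis
  proof (cases "i \<le> k")
    case True
    then have "A k j" using convex[of i j k] ij by auto
    then show ?thesis using convex[of k j "Suc k"] ij k True by auto
  next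
    case False
    then have "A i k" using convex[of i j k] ij by auto
    then show ?thesis using convex[of i k "Suc k"] ij k False by auto
  qed
qed

text \<open>Pick one of the two vertices of every pair but the \<^term>\<open>i\<close>-th.\<close>

lemma exchange:
  assumes "i \<in> {1..m}" "j \<in> {1..m}" "k \<in> {1..m}" "A i j" "j \<noteq> i" "A k i" "k \<noteq> i"
  shows "j = k"
proof (rule ccontr)
  assume "j \<noteq> k"
  \<comment> \<open>Pair \<open>j\<close> contributes its column vertex, every other pair except
    \<open>i\<close> its row vertex. The omitted row \<open>i\<close> is adjacent to column
    \<open>j\<close>, and column \<open>i\<close> to row \<open>k\<close>, which is kept because
    \<open>k \<noteq> j\<close>.\<close>
  have "m \<le> card ({1..m} - {i, j}) + card {j}"
  proof (rule dominating_card)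
    fix r assume "r \<in> {1..m}"
    then show "r \<in> {1..m} - {i, j} \<or> (\<exists>j\<in>{j}. A r j)" using assms diagonal by auto
  next
    fix c assume c: "c \<in> {1..m}"
    show "c \<in> {j} \<or> (\<exists>i\<in>{1..m} - {i, j}. A i c)"
    proof (cases "c = i")
      case True
      then show ?thesis using assms \<open>j \<noteq> k\<close> by auto
    next
      case False
      then show ?thesis using c diagonal[OF c] by blast
    qed
  qed (use assms in auto)
  moreover have "card ({1..m} - {i, j}) = m - 2"
    using assms by (subst card_Diff_subset) auto
  moreover have "m \<ge> 2" using assms by auto
  ultimately show False by simp
qed

text \<open>By \<open>exchange\<close> the two extra neighbours have the same index, so the pairs
  \<open>i\<close> and \<open>j\<close> are adjacent both ways and to no other pair. As consecutive
  pairs are linked, there would be only these two pairs.\<close>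

lemma row_or_column_leaf:
  assumes m: "m \<ge> 3" and i: "i \<in> {1..m}" and j: "j \<in> {1..m}" "A i j" "j \<noteq> i"
    and k: "k \<in> {1..m}" "A k i" "k \<noteq> i"
  shows False
proof -
  have "j = k" using exchange i j k by blast
  \<comment> \<open>By \<open>consecutive\<close>, \<open>a\<close> has an off-diagonal entry with
    each neighbouring index; \<open>exchange\<close> identifies that index with
    \<open>b\<close>.\<close>
  have *: "a < m \<Longrightarrow> b = Suc a" "1 < a \<Longrightarrow> a = Suc b"
    if "a \<in> {1..m}" "b \<in> {1..m}" "A a b" "A b a" "a \<noteq> b" for a b
  proof -
    show "b = Suc a" if "a < m"
      using consecutive[of a] exchange[of a b "Suc a"] exchange[of a "Suc a" b]
        \<open>a \<in> _\<close> \<open>b \<in> _\<close> \<open>A a b\<close> \<open>A b a\<close> \<open>a \<noteq> b\<close> that by auto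
    show "a = Suc b" if "1 < a"
    proof -
      obtain c where "a = Suc c" "1 \<le> c"
        using less_imp_Suc_add[OF \<open>1 < a\<close>] by auto
      then show ?thesis
        using consecutive[of c] exchange[of a b c] exchange[of a c b]
          \<open>a \<in> _\<close> \<open>b \<in> _\<close> \<open>A a b\<close> \<open>A b a\<close> \<open>a \<noteq> b\<close> by auto
    qed
  qed
  have ji: "A j i" using k \<open>j = k\<close> by simp
  have "i < m \<Longrightarrow> j = Suc i" "1 < i \<Longrightarrow> i = Suc j"
    by (erule *[OF i j(1,2) ji j(3)[symmetric]])+
  moreover have "j < m \<Longrightarrow> i = Suc j" "1 < j \<Longrightarrow> j = Suc i"
    by (erule *[OF j(1) i ji j(2) j(3)])+
  ultimately show False using m i j(1) unfolding atLeastAtMost_iff by linarith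
qed

text \<open>Rows with an off-diagonal entry alternate with rows without one. An entry further than
  one step from the diagonal would, by \<open>convex\<close>, put two such rows side by side. The
  witness for \<open>s\<close> is whether row \<open>1\<close> has such an entry.\<close>

theorem alternating:
  assumes m: "m \<ge> 3"
  obtains s where "\<And>i j. \<lbrakk>i \<in> {1..m}; j \<in> {1..m}\<rbrakk> \<Longrightarrow>
      A i j \<longleftrightarrow> i = j \<or> odd i = s \<and> (j = Suc i \<or> i = Suc j)"
proof -
  \<comment> \<open>\<open>R i\<close> says that the \<open>i\<close>-th row vertex is no leaf; then
    the \<open>i\<close>-th column vertex is one, by \<open>row_or_column_leaf\<close>.\<close>
  define R where "R i \<longleftrightarrow> (\<exists>j\<in>{1..m}. j \<noteq> i \<and> A i j)" for i
  have col_not_R: "\<not> R j" if "A i j" "i \<noteq> j" "i \<in> {1..m}" "j \<in> {1..m}" for i j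
    using that row_or_column_leaf[OF m, of j _ i] unfolding R_def by blast
  have R_Suc: "R (Suc k) \<longleftrightarrow> \<not> R k" if "1 \<le> k" "k < m" for k
    using consecutive[OF that] col_not_R[of k "Suc k"] col_not_R[of "Suc k" k] that
    unfolding R_def by (metis Suc_leI atLeastAtMost_iff le_Suc_eq less_imp_le_nat n_not_Suc_n)
  have R: "R i \<longleftrightarrow> odd i = R 1" if "i \<in> {1..m}" for i
  proof -
    have "1 \<le> i" using that by simp
    then show ?thesis using that
    proof (induction i rule: dec_induct)
      case (step k)
      then show ?case using R_Suc[of k] by auto
    qed auto
  qed
  show thesis
  proof (rule that)
    fix i j assume ij: "i \<in> {1..m}" "j \<in> {1..m}"
    show "A i j \<longleftrightarrow> i = j \<or> odd i = R 1 \<and> (j = Suc i \<or> i = Suc j)"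
    proof
      assume A: "A i j"
      show "i = j \<or> odd i = R 1 \<and> (j = Suc i \<or> i = Suc j)"
      proof (cases "i = j")
        case False
        then have "R i" using A ij unfolding R_def by (intro bexI[of _ j]) auto
        have "j = Suc i" if "i < j"
        proof (rule ccontr)
          assume "j \<noteq> Suc i"
          then have "R (Suc i)" using convex[OF ij A, of "Suc i"] that ij unfolding R_def by auto
          then show False using R_Suc[of i] \<open>R i\<close> ij that by auto
        qed
        moreover have "i = Suc j" if "j < i"
        proof (rule ccontr)
          assume "i \<noteq> Suc j"
          moreover obtain c where c: "i = Suc c" using \<open>j < i\<close> less_imp_Suc_add by blast
          ultimately have "R c" using convex[OF ij A, of c] that ij unfolding R_def by auto
          then show False using R_Suc[of c] \<open>R i\<close> c ij that by auto
        qed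
        ultimately show ?thesis using \<open>R i\<close> R ij False by (meson linorder_neqE_nat)
      qed auto
    next
      assume *: "i = j \<or> odd i = R 1 \<and> (j = Suc i \<or> i = Suc j)"
      show "A i j"
      proof (cases "i = j")
        case False
        then have "\<not> A j i" using * R[OF ij(1)] col_not_R[of j i] ij by auto
        then show ?thesis using * False consecutive[of i] consecutive[of j] ij by auto
      qed (use diagonal ij in auto)
    qed
  qed
qed

end

subsection \<open>Combs\<close>

text \<open>Symmetry turns connectedness into strong connectedness, and a walk from \<open>S\<close>
  to its complement leaves \<open>S\<close> along some arc.\<close>

lemma (in sym_digraph) connected_cut:
  assumes conn: "connected G" and S: "S \<subseteq> verts G" "S \<noteq> {}" "S \<noteq> verts G"
  obtains u v where "u \<in> S" "v \<in> verts G - S" "u \<rightarrow>\<^bsub>G\<^esub> v"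
proof -
  obtain a b where ab: "a \<in> S" "b \<in> verts G" "b \<notin> S" using S by blast
  have "strongly_connected G"
    using symmetric_connected_imp_strongly_connected[OF sym_arcs conn] .
  then have "a \<rightarrow>\<^sup>*\<^bsub>G\<^esub> b" using ab S by (auto simp: strongly_connected_def)
  then have "b \<in> S \<or> (\<exists>u\<in>S. \<exists>v\<in>verts G - S. u \<rightarrow>\<^bsub>G\<^esub> v)"
    by (induction rule: reachable_induct) (use ab adj_in_verts in blast)+
  then show thesis using ab that by blast
qed

lemma (in sym_digraph) connected_neighbour:
  assumes "connected G" "v \<in> verts G" "card (verts G) \<ge> 2"
  obtains w where "w \<in> verts G" "v \<rightarrow>\<^bsub>G\<^esub> w"
proof -
  have "{v} \<noteq> verts G"
  proof
    assume "{v} = verts G"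
    then have "card (verts G) = 1" by (metis is_singletonI is_singleton_altdef)
    then show False using assms by simp
  qed
  then show thesis using connected_cut[of "{v}"] assms that by blast
qed

lemma (in wf_digraph) strongly_connected_imp_connected:
  assumes "strongly_connected G"
  shows "connected G"
  using assms reachable_mk_symmetricI
  by (auto simp: connected_def strongly_connected_def)

context fin_digraph
begin

lemma finite_dominating_sets: "finite {D. dominating_set G D}"
  by (rule finite_subset[of _ "Pow (verts G)"]) (auto simp: dominating_set_def)

lemma domination_number_le:
  "dominating_set G D \<Longrightarrow> domination_number G \<le> card D"
  unfolding domination_number_def by (rule Min_le) (auto simp: finite_dominating_sets)

lemma domination_number_eqI:
  assumes "dominating_set G D" "card D = k" "\<And>D. dominating_set G D \<Longrightarrow> k \<le> card D"
  shows "domination_number G = k"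
  unfolding domination_number_def
  by (rule Min_eqI) (use assms finite_dominating_sets in auto)

end

lemma dominates_induce_subgraph:
  "u \<rightarrow>\<^bsub>G \<restriction> S\<^esub> v \<longleftrightarrow> u \<rightarrow>\<^bsub>G\<^esub> v \<and> u \<in> S \<and> v \<in> S"
  by (auto simp: arcs_ends_conv)

context graph
begin

text \<open>The matching makes \<open>V1\<close> dominating. Conversely, a vertex of
  \<open>V2\<close> is dominated only by itself or its partner, so distinct vertices of
  \<open>V2\<close> need distinct dominators.\<close>

theorem comb_domination_number:
  assumes "comb G"
  shows "domination_number G = card (verts G) div 2"
proof -
  let ?k = "card (verts G) div 2"
  obtain V1 V2 where V: "V1 \<union> V2 = verts G" "V1 \<inter> V2 = {}" "card V1 = ?k" "card V2 = ?k"
    and indep: "arcs (G \<restriction> V2) = {}" and pm: "perfect_matching G (edges_between G V1 V2)"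
    using assms unfolding comb_def by blast
  have unique: "\<exists>!e. e \<in> edges_between G V1 V2 \<and> v \<in> e" if "v \<in> verts G" for v
    using pm that unfolding perfect_matching_def by blast
  have no_arc: "\<not> u \<rightarrow>\<^bsub>G\<^esub> v" if "u \<in> V2" "v \<in> V2" for u v
  proof
    assume "u \<rightarrow>\<^bsub>G\<^esub> v"
    then obtain e where "e \<in> arcs G" "tail G e = u" "head G e = v" by (rule reachableE)
    then show False using indep that by auto
  qed
  have "dominating_set G V1"
    unfolding dominating_set_def
  proof (intro conjI ballI)
    fix v assume v: "v \<in> verts G"
    show "v \<in> V1 \<or> (\<exists>d\<in>V1. v \<rightarrow>\<^bsub>G\<^esub> d)"
    proof (cases "v \<in> V1")
      case False
      obtain a b where "a \<in> V1" "b \<in> V2" "a \<rightarrow>\<^bsub>G\<^esub> b" "v \<in> {a, b}"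
        using unique[OF v] unfolding edges_between_def by blast
      then show ?thesis using False graph_symmetric by blast
    qed simp
  qed (use V in blast)
  moreover have "?k \<le> card D" if D: "dominating_set G D" for D
  proof -
    have "\<forall>v\<in>V2. \<exists>d\<in>D. v = d \<or> v \<rightarrow>\<^bsub>G\<^esub> d"
      using D V unfolding dominating_set_def by blast
    then obtain d where d: "\<And>v. v \<in> V2 \<Longrightarrow> d v \<in> D \<and> (v = d v \<or> v \<rightarrow>\<^bsub>G\<^esub> d v)" by metis
    have "inj_on d V2"
    proof (rule inj_onI, rule ccontr)
      fix v w assume vw: "v \<in> V2" "w \<in> V2" "d v = d w" "v \<noteq> w"
      have dV: "d v \<in> verts G" using d D vw unfolding dominating_set_def by blast
      \<comment> \<open>If \<open>v\<close> or \<open>w\<close> were its own dominator, the other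
        one would be adjacent to it within \<open>V2\<close>.\<close>
      have ar: "v \<rightarrow>\<^bsub>G\<^esub> d v" "w \<rightarrow>\<^bsub>G\<^esub> d v"
        using d[OF vw(1)] d[OF vw(2)] vw no_arc by metis+
      then have "d v \<in> V1" using dV V no_arc vw by blast
      moreover have "d v \<rightarrow>\<^bsub>G\<^esub> v" "d v \<rightarrow>\<^bsub>G\<^esub> w" using ar graph_symmetric by blast+
      ultimately have "{d v, v} \<in> edges_between G V1 V2" "{d v, w} \<in> edges_between G V1 V2"
        using vw unfolding edges_between_def by blast+
      then have "{d v, v} = {d v, w}" using unique[OF dV] by blast
      then show False using vw \<open>d v \<in> V1\<close> V by (auto simp: doubleton_eq_iff)
    qed
    moreover have "finite D" using D finite_subset[OF _ finite_verts] unfolding dominating_set_def by blast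
    ultimately show ?thesis using card_inj_on_le[of d V2 D] d V by auto
  qed
  ultimately show ?thesis using V by (intro domination_number_eqI)
qed

text \<open>Spine \<open>h\<close> and teeth \<open>g\<close> describe the corona of a path in
  coordinates. Connectedness holds because everything is reached from \<open>h 1\<close> along the
  spine.\<close>

lemma path_corona:
  assumes m: "m \<ge> 1" and inj: "inj_on h {1..m}" "inj_on g {1..m}"
    and V: "h ` {1..m} \<inter> g ` {1..m} = {}" "verts G = h ` {1..m} \<union> g ` {1..m}"
    and hh: "\<And>i j. \<lbrakk>i \<in> {1..m}; j \<in> {1..m}\<rbrakk> \<Longrightarrow> h i \<rightarrow>\<^bsub>G\<^esub> h j \<longleftrightarrow> j = Suc i \<or> i = Suc j"
    and hg: "\<And>i j. \<lbrakk>i \<in> {1..m}; j \<in> {1..m}\<rbrakk> \<Longrightarrow> h i \<rightarrow>\<^bsub>G\<^esub> g j \<longleftrightarrow> i = j"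
    and gg: "\<And>i j. \<lbrakk>i \<in> {1..m}; j \<in> {1..m}\<rbrakk> \<Longrightarrow> \<not> g i \<rightarrow>\<^bsub>G\<^esub> g j"
  shows "comb G" and "connected G"
proof -
  let ?H = "h ` {1..m}" and ?K = "g ` {1..m}"
  have cards: "card ?H = m" "card ?K = m" using inj by (simp_all add: card_image)
  then have cV: "card (verts G) = 2 * m" using V by (simp add: card_Un_disjoint)
  have "path_graph (G \<restriction> ?H)"
    unfolding path_graph_def
  proof (intro exI conjI allI impI)
    show "map h [1..<Suc m] \<noteq> []" "distinct (map h [1..<Suc m])"
      using m inj by (simp_all add: distinct_map atLeastLessThanSuc_atLeastAtMost del: upt_Suc)
    show "set (map h [1..<Suc m]) = verts (G \<restriction> ?H)"
      by (simp add: atLeastLessThanSuc_atLeastAtMost del: upt_Suc)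
    fix i j assume ij: "i < length (map h [1..<Suc m])" "j < length (map h [1..<Suc m])"
    then show "map h [1..<Suc m] ! i \<rightarrow>\<^bsub>G \<restriction> ?H\<^esub> map h [1..<Suc m] ! j \<longleftrightarrow> j = Suc i \<or> i = Suc j"
      \<comment> \<open>List positions start at 0, spine indices at 1.\<close>
      using hh[of "Suc i" "Suc j"] by (auto simp: dominates_induce_subgraph simp del: upt_Suc)
  qed
  moreover have "arcs (G \<restriction> ?K) = {}"
    using gg in_arcs_imp_in_arcs_ends by fastforce
  moreover have "perfect_matching G (edges_between G ?H ?K)"
  proof -
    have eb: "edges_between G ?H ?K = (\<lambda>i. {h i, g i}) ` {1..m}"
      unfolding edges_between_def using hg by blast
    have "\<exists>!e. e \<in> edges_between G ?H ?K \<and> v \<in> e" if "v \<in> verts G" for v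
    proof -
      obtain i where i: "i \<in> {1..m}" "v \<in> {h i, g i}" using \<open>v \<in> verts G\<close> unfolding V(2) by blast
      have "i = j" if "j \<in> {1..m}" "v \<in> {h j, g j}" for j
      proof -
        have "h i \<noteq> g j" "h j \<noteq> g i" using V(1) i(1) that(1) by blast+
        then have "h i = h j \<or> g i = g j" using i(2) that(2) by auto
        then show ?thesis using inj i(1) that(1) by (auto simp: inj_on_eq_iff)
      qed
      then show ?thesis unfolding eb using i by blast
    qed
    then show ?thesis unfolding perfect_matching_def by (auto simp: edges_between_def)
  qed
  ultimately show "comb G"
    unfolding comb_def using V cV cards
    by (intro conjI exI[of _ ?H] exI[of _ ?K]) (simp_all del: induce_subgraph_arcs)
  have reach_h: "h 1 \<rightarrow>\<^sup>*\<^bsub>G\<^esub> h i" if "i \<in> {1..m}" for i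
  proof -
    have "1 \<le> i" using that by simp
    then show ?thesis using that
    proof (induction i rule: dec_induct)
      case base
      then show ?case using V by auto
    next
      case (step k)
      then have "h k \<rightarrow>\<^bsub>G\<^esub> h (Suc k)" "h 1 \<rightarrow>\<^sup>*\<^bsub>G\<^esub> h k" using hh[of k "Suc k"] by auto
      then show ?case by (rule reachable_adj_trans[rotated])
    qed
  qed
  have reach: "h 1 \<rightarrow>\<^sup>*\<^bsub>G\<^esub> v" if "v \<in> verts G" for v
  proof -
    obtain i where i: "i \<in> {1..m}" "v = h i \<or> v = g i" using \<open>v \<in> verts G\<close> unfolding V(2) by blast
    have "h i \<rightarrow>\<^bsub>G\<^esub> g i" using hg[OF i(1) i(1)] by simp
    from reachable_adj_trans[OF reach_h[OF i(1)] this] reach_h[OF i(1)] i(2) show ?thesis by blast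
  qed
  have "strongly_connected G"
  proof (rule strongly_connectedI)
    show "verts G \<noteq> {}" using m V by auto
    show "u \<rightarrow>\<^sup>*\<^bsub>G\<^esub> v" if "u \<in> verts G" "v \<in> verts G" for u v
      using reach[OF that(1)] reach[OF that(2)] symmetric_reachable[OF sym_arcs] reachable_trans
      by blast
  qed
  then show "connected G" by (rule strongly_connected_imp_connected)
qed

text \<open>Passes from the two sides of a bipartition to spine and teeth: \<open>u i\<close> joins
  the spine if \<open>odd i = s\<close>, otherwise \<open>l i\<close> does. Successive spine
  vertices thus lie on opposite sides, and \<open>ul\<close> links them to a path.\<close>

lemma alternating_corona:
  assumes m: "m \<ge> 1" and inj: "inj_on u {1..m}" "inj_on l {1..m}"
    and V: "u ` {1..m} \<inter> l ` {1..m} = {}" "verts G = u ` {1..m} \<union> l ` {1..m}"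
    and uu: "\<And>i j. \<lbrakk>i \<in> {1..m}; j \<in> {1..m}\<rbrakk> \<Longrightarrow> \<not> u i \<rightarrow>\<^bsub>G\<^esub> u j"
    and ll: "\<And>i j. \<lbrakk>i \<in> {1..m}; j \<in> {1..m}\<rbrakk> \<Longrightarrow> \<not> l i \<rightarrow>\<^bsub>G\<^esub> l j"
    and ul: "\<And>i j. \<lbrakk>i \<in> {1..m}; j \<in> {1..m}\<rbrakk> \<Longrightarrow>
      u i \<rightarrow>\<^bsub>G\<^esub> l j \<longleftrightarrow> i = j \<or> odd i = s \<and> (j = Suc i \<or> i = Suc j)"
  shows "comb G" and "connected G"
proof -
  define h where "h i = (if odd i = s then u i else l i)" for i
  define g where "g i = (if odd i = s then l i else u i)" for i
  have neq: "u i \<noteq> l j" if "i \<in> {1..m}" "j \<in> {1..m}" for i j using V that by blast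
  have lu: "l j \<rightarrow>\<^bsub>G\<^esub> u i \<longleftrightarrow> i = j \<or> odd i = s \<and> (j = Suc i \<or> i = Suc j)"
    if "i \<in> {1..m}" "j \<in> {1..m}" for i j
    using ul[OF that] graph_symmetric by blast
  have *: "inj_on h {1..m}" "inj_on g {1..m}"
    by (rule inj_onI; use inj neq neq[symmetric] in \<open>simp add: h_def g_def inj_on_eq_iff split: if_splits\<close>)+
  have "h i \<noteq> g j" if "i \<in> {1..m}" "j \<in> {1..m}" for i j
    using inj neq[of i j] neq[of j i] that
    by (cases "i = j") (auto simp: h_def g_def inj_on_eq_iff split: if_splits)
  then have disj: "h ` {1..m} \<inter> g ` {1..m} = {}" by blast
  have "{h i, g i} = {u i, l i}" for i by (auto simp: h_def g_def)
  then have "(\<Union>i\<in>{1..m}. {h i, g i}) = (\<Union>i\<in>{1..m}. {u i, l i})" by simp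
  then have cover: "verts G = h ` {1..m} \<union> g ` {1..m}" unfolding V(2) by blast
  have hh: "h i \<rightarrow>\<^bsub>G\<^esub> h j \<longleftrightarrow> j = Suc i \<or> i = Suc j"
    and hg: "h i \<rightarrow>\<^bsub>G\<^esub> g j \<longleftrightarrow> i = j" and gg: "\<not> g i \<rightarrow>\<^bsub>G\<^esub> g j"
    if "i \<in> {1..m}" "j \<in> {1..m}" for i j
    using that unfolding h_def g_def by (auto simp: uu ll ul lu)
  show "comb G" "connected G"
    by (rule path_corona[OF m * disj cover hh hg gg]; assumption)+
qed

end

subsection \<open>The two extremal permutations\<close>

text \<open>
  In the extremal permutation graph the \<open>i\<close>-th spine vertex is the \<open>i\<close>-th left-to-right maximum if
  \<open>odd i = s\<close> and the \<open>i\<close>-th right-to-left minimum otherwise. Then \<open>low s i\<close> is the position of the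
  \<open>i\<close>-th maximum and \<open>high m s i\<close> that of the \<open>i\<close>-th minimum; reading off values instead of positions
  exchanges the two kinds of records and negates \<open>s\<close>. For \<open>i = 1\<close> the truncated \<open>i - 2\<close> is the
  intended \<open>0\<close>.
\<close>

definition low :: "bool \<Rightarrow> nat \<Rightarrow> nat" where
  "low s i = i + (if odd i = s then i - 2 else i - 1)"

definition high :: "nat \<Rightarrow> bool \<Rightarrow> nat \<Rightarrow> nat" where
  "high m s i = i + (if odd i = s then i else min m (Suc i))"

text \<open>Each index has a window of two integers, here and in \<open>high_bounds\<close>. The
  windows alone decide monotonicity and every comparison of \<open>low s i\<close> with
  \<open>high m s j\<close> except for \<open>i = Suc j\<close>.\<close>

lemma low_bounds: "1 \<le> i \<Longrightarrow> 2 * i - 2 \<le> low s i \<and> low s i \<le> 2 * i - 1 \<and> 1 \<le> low s i"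
  by (auto simp: low_def)

lemma high_bounds: "i \<le> m \<Longrightarrow> 2 * i \<le> high m s i \<and> high m s i \<le> 2 * i + 1 \<and> high m s i \<le> 2 * m"
  by (auto simp: high_def)

lemma low_less: "1 \<le> i \<Longrightarrow> i < j \<Longrightarrow> low s i < low s j"
  using low_bounds[of i s] low_bounds[of j s] by linarith

lemma high_less: "i < j \<Longrightarrow> j \<le> m \<Longrightarrow> high m s i < high m s j"
  using high_bounds[of i m s] high_bounds[of j m s] by linarith

lemma low_less_high_iff:
  assumes "i \<in> {1..m}" "j \<in> {1..m}"
  shows "low s i < high m s j \<longleftrightarrow> i \<le> j \<or> odd i = s \<and> i = Suc j"
proof -
  consider "i \<le> j" | "i = Suc j" | "Suc (Suc j) \<le> i" by linarith
  then show ?thesis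
  proof cases
    case 1
    then show ?thesis using low_bounds[of i s] high_bounds[of j m s] assms by auto
  next
    \<comment> \<open>Both windows are \<open>{2 * j, 2 * j + 1}\<close>; since \<open>i\<close> and
      \<open>j\<close> differ in parity, the two values are distinct, in an order decided by
      \<open>s\<close>.\<close>
    case 2
    then show ?thesis using assms by (auto simp: low_def high_def min_def)
  next
    case 3
    then show ?thesis using low_bounds[of i s] high_bounds[of j m s] assms by auto
  qed
qed

lemma low_neq_high:
  assumes "i \<in> {1..m}" "j \<in> {1..m}"
  shows "low s i \<noteq> high m s j"
proof -
  consider "i \<le> j" | "i = Suc j" | "Suc (Suc j) \<le> i" by linarith
  then show ?thesis
  proof cases
    case 2
    then show ?thesis using assms by (auto simp: low_def high_def min_def)
  qed (use low_bounds[of i s] high_bounds[of j m s] assms in auto)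
qed

lemma inj_low: "inj_on (low s) {1..m}" and inj_high: "inj_on (high m s) {1..m}"
  by (rule linorder_inj_onI'; use low_less[of _ _ s] high_less[of _ _ m s] in fastforce)+

text \<open>Two disjoint sets of \<open>m\<close> elements inside \<open>{1..2 * m}\<close> exhaust
  it.\<close>

lemma low_high_cover:
  "low s ` {1..m} \<inter> high m s ` {1..m} = {}"
  "low s ` {1..m} \<union> high m s ` {1..m} = {1..2 * m}"
proof -
  show disj: "low s ` {1..m} \<inter> high m s ` {1..m} = {}"
    using low_neq_high by blast
  show "low s ` {1..m} \<union> high m s ` {1..m} = {1..2 * m}"
  proof (rule card_subset_eq)
    show "low s ` {1..m} \<union> high m s ` {1..m} \<subseteq> {1..2 * m}"
    proof -
      have "low s i \<in> {1..2 * m}" "high m s i \<in> {1..2 * m}" if "i \<in> {1..m}" for i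
        using low_bounds[of i s] high_bounds[of i m s] that by auto
      then show ?thesis by blast
    qed
    show "card (low s ` {1..m} \<union> high m s ` {1..m}) = card {1..2 * m}"
      using inj_low inj_high disj by (subst card_Un_disjoint) (auto simp: card_image)
  qed simp
qed

text \<open>Arguments are values of \<open>inv \<pi>\<close> and results are vertices. The second
  \<open>inv_into\<close> is reached only by elements of the range of
  \<open>high m (\<not> s)\<close>, by \<open>low_high_cover\<close>.\<close>

definition comb_perm :: "nat \<Rightarrow> bool \<Rightarrow> nat \<Rightarrow> nat" where
  "comb_perm m s v = (if v \<in> {1..2 * m}
     then if v \<in> low (\<not> s) ` {1..m} then high m s (inv_into {1..m} (low (\<not> s)) v)
          else low s (inv_into {1..m} (high m (\<not> s)) v)
     else v)"

lemma comb_perm_outside: "v \<notin> {1..2 * m} \<Longrightarrow> comb_perm m s v = v"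
  unfolding comb_perm_def by (rule if_not_P)

lemma comb_perm:
  assumes "i \<in> {1..m}"
  shows "comb_perm m s (low (\<not> s) i) = high m s i" "comb_perm m s (high m (\<not> s) i) = low s i"
proof -
  have *: "low (\<not> s) i \<in> {1..2*m}" "high m (\<not> s) i \<in> {1..2*m}" "high m (\<not> s) i \<notin> low (\<not> s) ` {1..m}"
    using low_high_cover[of "\<not> s" m] assms by blast+
  show "comb_perm m s (low (\<not> s) i) = high m s i" "comb_perm m s (high m (\<not> s) i) = low s i"
    using * assms inv_into_f_f[OF inj_low[of "\<not> s" m] assms] inv_into_f_f[OF inj_high[of m "\<not> s"] assms]
    by (simp_all add: comb_perm_def)
qed

lemma low_or_high:
  assumes "v \<in> {1..2 * m}"
  obtains i where "i \<in> {1..m}" "v = low s i \<or> v = high m s i"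
  using assms low_high_cover(2)[of s m] by blast

text \<open>Negating \<open>s\<close> exchanges the two coordinates of every record, so it inverts
  the permutation.\<close>

lemma comb_perm_comb_perm: "comb_perm m (\<not> s) (comb_perm m s v) = v"
proof (cases "v \<in> {1..2 * m}")
  case True
  then obtain i where i: "i \<in> {1..m}" "v = low (\<not> s) i \<or> v = high m (\<not> s) i" by (rule low_or_high)
  then show ?thesis using comb_perm[OF i(1), of s] comb_perm[OF i(1), of "\<not> s"] by auto
qed (simp add: comb_perm_outside)

lemma permutes_comb_perm: "comb_perm m s permutes {1..2 * m}"
proof -
  have "comb_perm m s (comb_perm m (\<not> s) v) = v" for v
    using comb_perm_comb_perm[of m "\<not> s" v] by simp
  then have "bij (comb_perm m s)"
    using comb_perm_comb_perm by (metis bijI')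
  moreover have "comb_perm m s v = v" if "v \<notin> {1..2*m}" for v
    using that by (rule comb_perm_outside)
  ultimately show ?thesis by (simp add: permutes_def bij_iff)
qed

lemma inv_comb_perm: "inv (comb_perm m s) = comb_perm m (\<not> s)"
  using comb_perm_comb_perm[of m s] comb_perm_comb_perm[of m "\<not> s"]
  by (intro inv_unique_comp) (auto simp: fun_eq_iff)

lemma inv_comb_perm_low_high:
  assumes "i \<in> {1..m}"
  shows "inv (comb_perm m s) (low s i) = high m (\<not> s) i" "inv (comb_perm m s) (high m s i) = low (\<not> s) i"
  using comb_perm[OF assms, of "\<not> s"] by (simp_all add: inv_comb_perm)

text \<open>The inverses already differ at vertex 1, which is \<open>low s 1\<close> for both
  \<open>s\<close>: their values there are 3 and 2.\<close>

lemma comb_perm_neq: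
  assumes "m \<ge> 2"
  shows "comb_perm m True \<noteq> comb_perm m False"
proof
  assume "comb_perm m True = comb_perm m False"
  then have "high m False 1 = high m True 1"
    using inv_comb_perm_low_high(1)[of 1 m True] inv_comb_perm_low_high(1)[of 1 m False] assms
    by (simp add: low_def)
  then show False using assms by (simp add: high_def)
qed

section \<open>Adjacency in the graphs of the extremal permutations\<close>

lemma dominates_permutation_graph:
  "v \<rightarrow>\<^bsub>permutation_graph n \<pi>\<^esub> w \<longleftrightarrow> v \<in> {1..n} \<and> w \<in> {1..n} \<and>
     (v < w \<and> inv \<pi> w < inv \<pi> v \<or> w < v \<and> inv \<pi> v < inv \<pi> w)"
  by (auto simp: permutation_graph_def with_proj_def arcs_ends_def arc_to_ends_def)

lemma graph_permutation_graph: "graph (permutation_graph n \<pi>)"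
proof -
  interpret pair_graph "permutation_graph n \<pi>" by (rule pair_graph_permutation_graph)
  show ?thesis by unfold_locales
qed

lemma verts_permutation_graph: "verts (permutation_graph n \<pi>) = {1..n}"
  by (simp add: permutation_graph_def)

text \<open>Both coordinates increase along each kind of record, so edges run only between the
  kinds; those are read off from \<open>low_less_high_iff\<close> for \<open>s\<close> and for
  \<open>\<not> s\<close>.\<close>

lemma alternating_permutation_graph:
  fixes m :: nat and \<pi> :: "nat \<Rightarrow> nat"
  assumes m: "m \<ge> 1"
    and low: "\<And>i. i \<in> {1..m} \<Longrightarrow> inv \<pi> (low s i) = high m (\<not> s) i"
    and high: "\<And>i. i \<in> {1..m} \<Longrightarrow> inv \<pi> (high m s i) = low (\<not> s) i"
  shows "comb (permutation_graph (2 * m) \<pi>)"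
    and "Digraph_Component.connected (permutation_graph (2 * m) \<pi>)"
proof -
  interpret graph "permutation_graph (2 * m) \<pi>" by (rule graph_permutation_graph)
  have V: "low s i \<in> {1..2 * m}" "high m s i \<in> {1..2 * m}" if "i \<in> {1..m}" for i
    using low_high_cover(2)[of s m] that by blast+
  have ll: "\<not> low s i \<rightarrow>\<^bsub>permutation_graph (2 * m) \<pi>\<^esub> low s j" if "i \<in> {1..m}" "j \<in> {1..m}" for i j
    unfolding dominates_permutation_graph low[OF that(1)] low[OF that(2)]
    using low_less[of i j s] low_less[of j i s] high_less[of i j m "\<not> s"] high_less[of j i m "\<not> s"] that
    by (cases i j rule: linorder_cases) auto
  have hh: "\<not> high m s i \<rightarrow>\<^bsub>permutation_graph (2 * m) \<pi>\<^esub> high m s j" if "i \<in> {1..m}" "j \<in> {1..m}" for i j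
    unfolding dominates_permutation_graph high[OF that(1)] high[OF that(2)]
    using low_less[of i j "\<not> s"] low_less[of j i "\<not> s"] high_less[of i j m s] high_less[of j i m s] that
    by (cases i j rule: linorder_cases) auto
  have lh: "low s i \<rightarrow>\<^bsub>permutation_graph (2 * m) \<pi>\<^esub> high m s j \<longleftrightarrow> i = j \<or> odd i = s \<and> (j = Suc i \<or> i = Suc j)"
    if "i \<in> {1..m}" "j \<in> {1..m}" for i j
  proof -
    \<comment> \<open>An inversion of this orientation would require both \<open>j < i\<close> and
      \<open>i < j\<close>.\<close>
    have "\<not> (high m s j < low s i \<and> high m (\<not> s) i < low (\<not> s) j)"
      using low_less_high_iff[OF that, of s] low_less_high_iff[OF that(2,1), of "\<not> s"] by auto
    then have "low s i \<rightarrow>\<^bsub>permutation_graph (2 * m) \<pi>\<^esub> high m s j \<longleftrightarrow>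
        low s i < high m s j \<and> low (\<not> s) j < high m (\<not> s) i"
      unfolding dominates_permutation_graph low[OF that(1)] high[OF that(2)]
      using V that by auto
    \<comment> \<open>For \<open>j = Suc i\<close> the condition \<open>odd j = (\<not> s)\<close>
      amounts to \<open>odd i = s\<close>.\<close>
    also have "\<dots> \<longleftrightarrow> i = j \<or> odd i = s \<and> (j = Suc i \<or> i = Suc j)"
      using low_less_high_iff[OF that, of s] low_less_high_iff[OF that(2,1), of "\<not> s"] by auto
    finally show ?thesis .
  qed
  show "comb (permutation_graph (2 * m) \<pi>)"
    "Digraph_Component.connected (permutation_graph (2 * m) \<pi>)"
    by (rule alternating_corona[OF m inj_low inj_high low_high_cover(1) _ ll hh lh];
        simp only: verts_permutation_graph low_high_cover(2))+
qed

lemma comb_perm_unique: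
  assumes \<pi>: "\<pi> permutes {1..2 * m}"
    and low: "\<And>i. i \<in> {1..m} \<Longrightarrow> inv \<pi> (low s i) = high m (\<not> s) i"
    and high: "\<And>i. i \<in> {1..m} \<Longrightarrow> inv \<pi> (high m s i) = low (\<not> s) i"
  shows "\<pi> = comb_perm m s"
proof
  fix v
  show "\<pi> v = comb_perm m s v"
  proof (cases "v \<in> {1..2 * m}")
    case True
    then obtain i where i: "i \<in> {1..m}" "v = low (\<not> s) i \<or> v = high m (\<not> s) i" by (rule low_or_high)
    have "\<pi> (high m (\<not> s) i) = low s i" "\<pi> (low (\<not> s) i) = high m s i"
      using low[OF i(1)] high[OF i(1)] permutes_inverses(1)[OF \<pi>] by metis+
    then show ?thesis using i comb_perm[OF i(1), of s] by auto
  qed (simp add: comb_perm_outside permutes_not_in[OF \<pi>])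
qed

subsection \<open>Records of a permutation\<close>

text \<open>With \<open>f\<close> the position and \<open>g\<close> the value of an entry these are the left-to-right maxima;
  with the roles of \<open>f\<close> and \<open>g\<close> exchanged they are the right-to-left minima.\<close>

definition records :: "('a \<Rightarrow> nat) \<Rightarrow> ('a \<Rightarrow> nat) \<Rightarrow> 'a set \<Rightarrow> 'a set" where
  "records f g V = {v \<in> V. \<forall>w\<in>V. f w < f v \<longrightarrow> g w < g v}"

text \<open>Among the elements that witness the failure for \<open>v\<close>, one with largest
  \<open>g\<close> is a record. In the graph, this makes every non-record adjacent to a
  record.\<close>

lemma ex_record_above:
  assumes V: "finite V" "inj_on g V" and v: "v \<in> V" "v \<notin> records f g V"
  shows "\<exists>w\<in>records f g V. f w < f v \<and> g v < g w"
proof -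
  define S where "S = {w \<in> V. f w < f v \<and> g v < g w}"
  obtain x where "x \<in> V" "f x < f v" "\<not> g x < g v" using v by (auto simp: records_def)
  moreover have "g x \<noteq> g v" using \<open>f x < f v\<close> inj_onD[OF V(2) _ \<open>x \<in> V\<close> v(1)] by auto
  ultimately have "x \<in> S" by (auto simp: S_def)
  then have "S \<noteq> {}" "finite S" using V by (auto simp: S_def)
  then obtain w where w: "w \<in> S" "g w = Max (g ` S)" using Max_in[of "g ` S"] by fastforce
  have "w \<in> records f g V"
    unfolding records_def
  proof (intro CollectI conjI ballI impI)
    show "w \<in> V" using w by (simp add: S_def)
    fix y assume y: "y \<in> V" "f y < f w"
    show "g y < g w"
    proof (rule ccontr)
      assume "\<not> g y < g w"
      moreover have "g w \<noteq> g y" using inj_onD[OF V(2), of w y] \<open>w \<in> V\<close> y by auto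
      ultimately have "g w < g y" by simp
      then have "y \<in> S" using y w by (auto simp: S_def)
      then have "g y \<le> g w" using w \<open>finite S\<close> by simp
      then show False using \<open>g w < g y\<close> by simp
    qed
  qed
  then show ?thesis using w by (auto simp: S_def)
qed

lemma increasing_enumeration:
  fixes M :: "nat set"
  assumes "finite M"
  obtains h where "inj_on h {1..card M}" "h ` {1..card M} = M"
    "\<And>i j. \<lbrakk>i \<in> {1..card M}; j \<in> {1..card M}\<rbrakk> \<Longrightarrow> h i \<le> h j \<longleftrightarrow> i \<le> j"
proof -
  obtain h where h: "bij_betw h {..<card M} M" "strict_mono_on {..<card M} h"
    using ex_bij_betw_strict_mono_card[OF assms] .
  have "bij_betw (\<lambda>i. i - 1) {1..card M} {..<card M}"
    by (rule bij_betw_byWitness[where f' = Suc]) auto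
  then have "bij_betw (h \<circ> (\<lambda>i. i - 1)) {1..card M} M" using h(1) by (rule bij_betw_trans)
  moreover have less: "(h \<circ> (\<lambda>i. i - 1)) i < (h \<circ> (\<lambda>i. i - 1)) j"
    if "i \<in> {1..card M}" "j \<in> {1..card M}" "i < j" for i j
  proof -
    have "i - 1 < card M" "j - 1 < card M" "i - 1 < j - 1" using that by auto
    then show ?thesis using strict_mono_onD[OF h(2)] by simp
  qed
  have "(h \<circ> (\<lambda>i. i - 1)) i \<le> (h \<circ> (\<lambda>i. i - 1)) j \<longleftrightarrow> i \<le> j"
    if "i \<in> {1..card M}" "j \<in> {1..card M}" for i j
    using less[OF that] less[OF that(2,1)] by (cases i j rule: linorder_cases) force+
  ultimately show thesis using that unfolding bij_betw_def by blast
qed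

text \<open>A bijection onto \<open>{1..N}\<close> equals its own rank function, and the rank is
  counted separately over the two kinds. This is the source of the two-term formulas
  \<open>low\<close> and \<open>high\<close>.\<close>

lemma rank_eq:
  assumes f: "inj_on f V" "f ` V = {1..N}" and V: "V = u ` I \<union> l ` I" "u ` I \<inter> l ` I = {}"
    and I: "finite I" "inj_on u I" "inj_on l I" and v: "v \<in> V"
  shows "f v = card {i \<in> I. f (u i) \<le> f v} + card {i \<in> I. f (l i) \<le> f v}"
proof -
  have "f ` {w \<in> V. f w \<le> f v} = {1..f v}"
  proof
    show "{1..f v} \<subseteq> f ` {w \<in> V. f w \<le> f v}"
    proof
      fix x assume x: "x \<in> {1..f v}"
      moreover have "f v \<in> {1..N}" using v f(2) by blast
      ultimately have "x \<in> f ` V" unfolding f(2) by simp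
      then show "x \<in> f ` {w \<in> V. f w \<le> f v}" using x by auto
    qed
    show "f ` {w \<in> V. f w \<le> f v} \<subseteq> {1..f v}" using f(2) by fastforce
  qed
  moreover have "inj_on f {w \<in> V. f w \<le> f v}" using f(1) by (rule inj_on_subset) auto
  ultimately have "f v = card {w \<in> V. f w \<le> f v}" using card_image by fastforce
  also have "{w \<in> V. f w \<le> f v} = u ` {i \<in> I. f (u i) \<le> f v} \<union> l ` {i \<in> I. f (l i) \<le> f v}"
    unfolding V(1) by blast
  also have "card \<dots> = card (u ` {i \<in> I. f (u i) \<le> f v}) + card (l ` {i \<in> I. f (l i) \<le> f v})"
    using I V(2) by (intro card_Un_disjoint) auto
  also have "card (u ` {i \<in> I. f (u i) \<le> f v}) = card {i \<in> I. f (u i) \<le> f v}"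
    by (rule card_image, rule inj_on_subset[OF I(2)]) auto
  also have "card (l ` {i \<in> I. f (l i) \<le> f v}) = card {i \<in> I. f (l i) \<le> f v}"
    by (rule card_image, rule inj_on_subset[OF I(3)]) auto
  finally show ?thesis .
qed

section \<open>From domination number \<open>m\<close> to an extremal permutation\<close>

text \<open>A record of both kinds lies in no inversion, so it would be isolated. Both record sets
  dominate by \<open>ex_record_above\<close>, and two disjoint sets of at least \<open>m\<close>
  among \<open>2 * m\<close> vertices have exactly \<open>m\<close> each.\<close>

lemma record_halves:
  fixes m :: nat and \<pi> :: "nat \<Rightarrow> nat"
  defines "V \<equiv> {1..2 * m}" and "y \<equiv> inv \<pi>"
  assumes \<pi>: "\<pi> permutes V" and m: "m \<ge> 1"
    and conn: "Digraph_Component.connected (permutation_graph (2 * m) \<pi>)"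
    and dom: "domination_number (permutation_graph (2 * m) \<pi>) = m"
  shows "records id y V \<inter> records y id V = {}" "records id y V \<union> records y id V = V"
    "card (records id y V) = m" "card (records y id V) = m"
proof -
  let ?G = "with_proj (permutation_graph (2 * m) \<pi>)"
  let ?U = "records id y V" and ?L = "records y id V"
  interpret graph ?G by (rule graph_permutation_graph)
  have arc: "v \<rightarrow>\<^bsub>?G\<^esub> w \<longleftrightarrow> v \<in> V \<and> w \<in> V \<and> (v < w \<and> y w < y v \<or> w < v \<and> y v < y w)" for v w
    unfolding dominates_permutation_graph V_def y_def by simp
  have verts: "verts ?G = V" unfolding verts_permutation_graph V_def ..
  have inj: "inj_on y V"
    using permutes_inj[OF permutes_inv[OF \<pi>]] unfolding y_def by (rule inj_on_subset) simp
  have fin: "finite V" by (simp add: V_def)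
  have sub: "?U \<subseteq> V" "?L \<subseteq> V" by (auto simp: records_def)
  show disj: "?U \<inter> ?L = {}"
  proof (rule ccontr)
    assume "?U \<inter> ?L \<noteq> {}"
    then obtain v where v: "v \<in> ?U" "v \<in> ?L" by blast
    have "v \<in> verts ?G" "card (verts ?G) \<ge> 2" using v(1) sub m unfolding verts V_def by auto
    then obtain w where "v \<rightarrow>\<^bsub>?G\<^esub> w" using connected_neighbour[OF conn] by blast
    then show False using v unfolding arc records_def by auto
  qed
  have "dominating_set ?G ?U"
    unfolding dominating_set_def verts
  proof (intro conjI ballI)
    fix v assume "v \<in> V"
    then show "v \<in> ?U \<or> (\<exists>d\<in>?U. v \<rightarrow>\<^bsub>?G\<^esub> d)"
      using sub ex_record_above[OF fin inj, of v id] unfolding arc id_apply by blast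
  qed (rule sub)
  then have U: "m \<le> card ?U" using domination_number_le dom by metis
  have "dominating_set ?G ?L"
    unfolding dominating_set_def verts
  proof (intro conjI ballI)
    fix v assume "v \<in> V"
    then show "v \<in> ?L \<or> (\<exists>d\<in>?L. v \<rightarrow>\<^bsub>?G\<^esub> d)"
      using sub ex_record_above[OF fin inj_on_id, of v y] unfolding arc id_apply by blast
  qed (rule sub)
  then have L: "m \<le> card ?L" using domination_number_le dom by metis
  have "card (?U \<union> ?L) = card ?U + card ?L"
    using disj sub fin by (meson card_Un_disjoint finite_subset)
  moreover have "card (?U \<union> ?L) \<le> 2 * m"
    using card_mono[OF fin, of "?U \<union> ?L"] sub by (simp add: V_def)
  ultimately show "card ?U = m" "card ?L = m" using U L by linarith+
  then show "?U \<union> ?L = V"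
    using \<open>card (?U \<union> ?L) = _\<close> sub fin by (intro card_subset_eq) (auto simp: V_def)
qed

text \<open>The enumerated records satisfy \<open>crossing_relation\<close>; the pattern from
  \<open>alternating\<close> fixes the order of all records in both coordinates, and ranks turn that
  order into \<open>low\<close> and \<open>high\<close>.\<close>

theorem domination_number_half_imp_comb_perm:
  fixes m :: nat
  assumes \<pi>: "\<pi> permutes {1..2 * m}" and m: "m \<ge> 3"
    and conn: "Digraph_Component.connected (permutation_graph (2 * m) \<pi>)"
    and dom: "domination_number (permutation_graph (2 * m) \<pi>) = m"
  obtains s where "\<pi> = comb_perm m s"
proof -
  let ?G = "with_proj (permutation_graph (2 * m) \<pi>)" and ?V = "{1..2 * m}" and ?I = "{1..m}"
  interpret graph ?G by (rule graph_permutation_graph)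
  define y where "y = inv \<pi>"
  \<comment> \<open>The vertex serves as position and \<open>y\<close> as value, so these are
    records of the one-line notation of \<open>inv \<pi>\<close>.\<close>
  define U where "U = records id y ?V"
  define L where "L = records y id ?V"
  have m1: "m \<ge> 1" using m by simp
  note halves = record_halves[OF \<pi> m1 conn dom, folded y_def, folded U_def L_def]
  have fin: "finite U" "finite L" by (auto simp: U_def L_def records_def)
  obtain u where u: "inj_on u ?I" "u ` ?I = U"
    and u_le: "\<And>i j. i \<in> ?I \<Longrightarrow> j \<in> ?I \<Longrightarrow> u i \<le> u j \<longleftrightarrow> i \<le> j"
    using increasing_enumeration[OF fin(1)] unfolding halves(3) by blast
  obtain l where l: "inj_on l ?I" "l ` ?I = L"
    and l_le: "\<And>i j. i \<in> ?I \<Longrightarrow> j \<in> ?I \<Longrightarrow> l i \<le> l j \<longleftrightarrow> i \<le> j"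
    using increasing_enumeration[OF fin(2)] unfolding halves(4) by blast
  have V: "?V = u ` ?I \<union> l ` ?I" "u ` ?I \<inter> l ` ?I = {}" using halves u l by auto
  have uU: "u i \<in> U" and lL: "l i \<in> L" and uV: "u i \<in> ?V" and lV: "l i \<in> ?V" if "i \<in> ?I" for i
    using u(2) l(2) V(1) that by blast+
  have ul_neq: "u i \<noteq> l j" if "i \<in> ?I" "j \<in> ?I" for i j using V(2) that by blast
  have inj_y: "inj y" unfolding y_def by (rule permutes_inj[OF permutes_inv[OF \<pi>]])
  have y_V: "y ` ?V = ?V" unfolding y_def by (rule permutes_image[OF permutes_inv[OF \<pi>]])
  have record_u: "v < u i \<Longrightarrow> y v < y (u i)" if "i \<in> ?I" "v \<in> ?V" for i v
    using uU[OF that(1)] that(2) by (auto simp: U_def records_def)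
  have record_l: "y v < y (l i) \<Longrightarrow> v < l i" if "i \<in> ?I" "v \<in> ?V" for i v
    using lL[OF that(1)] that(2) by (auto simp: L_def records_def)
  have yu_le: "y (u i) \<le> y (u j) \<longleftrightarrow> i \<le> j" if "i \<in> ?I" "j \<in> ?I" for i j
    using record_u[OF that(1) uV[OF that(2)]] record_u[OF that(2) uV[OF that(1)]]
      u_le[OF that] u_le[OF that(2,1)] by (cases i j rule: linorder_cases) auto
  have yl_less: "y (l i) < y (l j)" if "i \<in> ?I" "j \<in> ?I" "i < j" for i j
  proof -
    have "\<not> l j \<le> l i" using l_le[OF that(2,1)] that(3) by simp
    moreover have "\<not> y (l j) < y (l i)" using record_l[OF that(1) lV[OF that(2)]] calculation by linarith
    moreover have "y (l i) \<noteq> y (l j)" using injD[OF inj_y, of "l i" "l j"] calculation by auto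
    ultimately show ?thesis by linarith
  qed
  have yl_le: "y (l i) \<le> y (l j) \<longleftrightarrow> i \<le> j" if "i \<in> ?I" "j \<in> ?I" for i j
    using yl_less[OF that] yl_less[OF that(2,1)] by (cases i j rule: linorder_cases) auto
  have arc: "v \<rightarrow>\<^bsub>?G\<^esub> w \<longleftrightarrow> v \<in> ?V \<and> w \<in> ?V \<and> (v < w \<and> y w < y v \<or> w < v \<and> y v < y w)" for v w
    unfolding dominates_permutation_graph y_def by simp
  have verts: "verts ?G = ?V" by (rule verts_permutation_graph)
  define A where "A i j \<longleftrightarrow> u i < l j \<and> y (l j) < y (u i)" for i j
  have uu: "\<not> u i \<rightarrow>\<^bsub>?G\<^esub> u j" if "i \<in> ?I" "j \<in> ?I" for i j
    unfolding arc using u_le[OF that] u_le[OF that(2,1)] yu_le[OF that] yu_le[OF that(2,1)] by linarith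
  have ll: "\<not> l i \<rightarrow>\<^bsub>?G\<^esub> l j" if "i \<in> ?I" "j \<in> ?I" for i j
    unfolding arc using l_le[OF that] l_le[OF that(2,1)] yl_le[OF that] yl_le[OF that(2,1)] by linarith
  \<comment> \<open>The other orientation of an inversion, with \<open>l j < u i\<close>, is
    excluded because \<open>u i\<close> is a record.\<close>
  have ul: "u i \<rightarrow>\<^bsub>?G\<^esub> l j \<longleftrightarrow> A i j" if "i \<in> ?I" "j \<in> ?I" for i j
    unfolding arc A_def using record_u[OF that(1) lV[OF that(2)]] uV[OF that(1)] lV[OF that(2)] by auto
  have lu: "l j \<rightarrow>\<^bsub>?G\<^esub> u i \<longleftrightarrow> A i j" if "i \<in> ?I" "j \<in> ?I" for i j
    using ul[OF that] graph_symmetric by blast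
  have vert_cases: "\<exists>i\<in>?I. v = u i \<or> v = l i" if "v \<in> ?V" for v using that V(1) by blast
  have neighbour: "\<exists>w\<in>?V. v \<rightarrow>\<^bsub>?G\<^esub> w" if "v \<in> ?V" for v
  proof -
    have "v \<in> verts ?G" "card (verts ?G) \<ge> 2" using that m unfolding verts by auto
    then show ?thesis using connected_neighbour[OF conn] verts by metis
  qed
  have "crossing_relation m A"
  proof
    fix i j i' j' assume *: "i \<in> ?I" "j \<in> ?I" "i' \<in> ?I" "j' \<in> ?I" "i \<le> i'" "j' \<le> j" "A i j" "A i' j'"
    have "u i \<le> u i'" "y (u i) \<le> y (u i')" "l j' \<le> l j" "y (l j') \<le> y (l j)"
      using * u_le yu_le l_le yl_le by blast+
    then show "A i j' \<and> A i' j" using *(7,8) unfolding A_def by linarith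
  next
    fix i assume i: "i \<in> ?I"
    then show "\<exists>j\<in>?I. A i j" using neighbour[OF uV[OF i]] vert_cases uu ul by metis
  next
    fix j assume j: "j \<in> ?I"
    then show "\<exists>i\<in>?I. A i j" using neighbour[OF lV[OF j]] vert_cases ll lu by metis
  next
    fix k assume k: "1 \<le> k" "k < m"
    \<comment> \<open>Cutting after the first \<open>k\<close> records of both kinds, an edge that
      leaves this set joins an index up to \<open>k\<close> with a larger one.\<close>
    let ?S = "u ` {1..k} \<union> l ` {1..k}"
    have kI: "{1..k} \<subseteq> ?I" using k by auto
    have "Suc k \<in> ?I" using k by auto
    have "u (Suc k) \<notin> ?S"
    proof
      assume "u (Suc k) \<in> ?S"
      then obtain i where i: "i \<in> {1..k}" "u (Suc k) = u i \<or> u (Suc k) = l i" by blast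
      then have "u (Suc k) = u i" using ul_neq[OF \<open>Suc k \<in> ?I\<close>] kI by blast
      then show False using inj_onD[OF u(1) _ \<open>Suc k \<in> ?I\<close>, of i] i(1) kI by auto
    qed
    then have "?S \<noteq> verts ?G" using uV[OF \<open>Suc k \<in> ?I\<close>] verts by blast
    moreover have "?S \<subseteq> verts ?G" unfolding verts V(1) using kI by blast
    moreover have "?S \<noteq> {}" using k by auto
    ultimately obtain a b where ab: "a \<in> ?S" "b \<in> verts ?G - ?S" "a \<rightarrow>\<^bsub>?G\<^esub> b"
      using connected_cut[OF conn, of ?S] by metis
    obtain i where i: "i \<in> {1..k}" "a = u i \<or> a = l i" using ab(1) by blast
    obtain j where j: "j \<in> ?I" "b = u j \<or> b = l j" using ab(2) vert_cases verts by blast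
    have "j \<notin> {1..k}" using j(2) ab(2) by blast
    then have kj: "k < j" using j(1) by auto
    have iI: "i \<in> ?I" using i(1) kI by blast
    have "A i j \<or> A j i"
      using i(2) j(2) ab(3) uu[OF iI j(1)] ll[OF iI j(1)] ul[OF iI j(1)] lu[OF j(1) iI] by blast
    then show "\<exists>i\<in>?I. \<exists>j\<in>?I. A i j \<and> (i \<le> k \<and> k < j \<or> j \<le> k \<and> k < i)"
      using iI j(1) i(1) kj by (meson atLeastAtMost_iff)
  next
    fix X Y assume X: "X \<subseteq> ?I" and Y: "Y \<subseteq> ?I"
      and rows: "\<And>i. i \<in> ?I \<Longrightarrow> i \<in> X \<or> (\<exists>j\<in>Y. A i j)"
      and cols: "\<And>j. j \<in> ?I \<Longrightarrow> j \<in> Y \<or> (\<exists>i\<in>X. A i j)"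
    let ?D = "u ` X \<union> l ` Y"
    have "dominating_set ?G ?D"
      unfolding dominating_set_def verts
    proof (intro conjI ballI)
      show "?D \<subseteq> ?V" using X Y V(1) by blast
      fix v assume "v \<in> ?V"
      then obtain i where i: "i \<in> ?I" "v = u i \<or> v = l i" using vert_cases by blast
      then show "v \<in> ?D \<or> (\<exists>d\<in>?D. v \<rightarrow>\<^bsub>?G\<^esub> d)"
        using rows[OF i(1)] cols[OF i(1)] ul[OF i(1)] lu[OF _ i(1)] X Y by blast
    qed
    then have "m \<le> card ?D" using domination_number_le dom by metis
    also have "\<dots> \<le> card (u ` X) + card (l ` Y)" by (rule card_Un_le)
    also have "\<dots> \<le> card X + card Y"
      using X Y by (intro add_mono card_image_le) (auto intro: finite_subset)
    finally show "m \<le> card X + card Y" .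
  qed
  then obtain s where s: "\<And>i j. i \<in> ?I \<Longrightarrow> j \<in> ?I \<Longrightarrow>
      A i j \<longleftrightarrow> i = j \<or> odd i = s \<and> (j = Suc i \<or> i = Suc j)"
    using crossing_relation.alternating[OF _ m] by metis
  \<comment> \<open>For \<open>i \<le> j\<close>, \<open>u i \<le> u j < l j\<close> by the diagonal
    entry \<open>A j j\<close>. For \<open>j < i\<close>, \<open>A i i\<close> already gives
    \<open>y (l j) < y (u i)\<close>, so the comparison is \<open>A i j\<close> itself.\<close>
  have u_less_l: "u i < l j \<longleftrightarrow> i \<le> j \<or> odd i = s \<and> i = Suc j" if ij: "i \<in> ?I" "j \<in> ?I" for i j
  proof (cases "i \<le> j")
    case True
    then show ?thesis using s[OF ij(2,2)] u_le[OF ij] unfolding A_def by simp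
  next
    case False
    then have "y (l j) < y (u i)"
      using s[OF ij(1,1)] yl_le[OF ij] yl_le[OF ij(2,1)] unfolding A_def by simp
    then show ?thesis using s[OF ij] False unfolding A_def by auto
  qed
  have yl_less_yu: "y (l j) < y (u i) \<longleftrightarrow> j \<le> i \<or> odd i = s \<and> j = Suc i" if ij: "i \<in> ?I" "j \<in> ?I" for i j
  proof (cases "j \<le> i")
    case True
    then show ?thesis using s[OF ij(1,1)] yl_le[OF ij(2,1)] unfolding A_def by simp
  next
    case False
    then have "u i < l j"
      using s[OF ij(2,2)] u_le[OF ij] unfolding A_def by simp
    then show ?thesis using s[OF ij] False unfolding A_def by auto
  qed
  have rank_id: "v = card {i \<in> ?I. u i \<le> v} + card {i \<in> ?I. l i \<le> v}" if "v \<in> ?V" for v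
    using rank_eq[of id ?V "2 * m" u ?I l v] V u(1) l(1) that by simp
  have rank_y: "y v = card {i \<in> ?I. y (u i) \<le> y v} + card {i \<in> ?I. y (l i) \<le> y v}" if "v \<in> ?V" for v
    using rank_eq[of y ?V "2 * m" u ?I l v] V u(1) l(1) y_V inj_on_subset[OF inj_y] that by simp
  have upto: "{i \<in> ?I. i \<le> k} = {1..k}" if "k \<in> ?I" for k using that by auto
  \<comment> \<open>For \<open>k = 1\<close> both truncated differences are 0 and the interval is
    empty, as it should be.\<close>
  have below: "{i \<in> ?I. \<not> (k \<le> i \<or> P \<and> k = Suc i)} = {1..(if P then k - 2 else k - 1)}" if "k \<in> ?I" for k P
    using that by auto
  have above: "{i \<in> ?I. i \<le> k \<or> P \<and> i = Suc k} = {1..(if P then min m (Suc k) else k)}" if "k \<in> ?I" for k P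
    using that by auto
  \<comment> \<open>Each coordinate is its rank: \<open>k\<close> from records of the same kind,
    plus the number of smaller records of the other kind.\<close>
  have u_low: "u k = low s k" and yu_high: "y (u k) = high m (\<not> s) k"
    and l_high: "l k = high m s k" and yl_low: "y (l k) = low (\<not> s) k" if k: "k \<in> ?I" for k
  proof -
    have "{i \<in> ?I. u i \<le> u k} = {1..k}" using u_le k by auto
    moreover have "{i \<in> ?I. l i \<le> u k} = {i \<in> ?I. \<not> (k \<le> i \<or> odd k = s \<and> k = Suc i)}"
      using u_less_l[OF k] by (auto simp: not_less[symmetric])
    ultimately show "u k = low s k"
      using rank_id[OF uV[OF k]] unfolding below[OF k] low_def by (simp split: if_splits)
    have "{i \<in> ?I. y (u i) \<le> y (u k)} = {1..k}" using yu_le k by auto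
    moreover have "{i \<in> ?I. y (l i) \<le> y (u k)} = {i \<in> ?I. i \<le> k \<or> odd k = s \<and> i = Suc k}"
      using yl_less_yu[OF k] ul_neq[OF k] injD[OF inj_y] by (metis (no_types, lifting) le_neq_implies_less less_imp_le_nat)
    ultimately show "y (u k) = high m (\<not> s) k"
      using rank_y[OF uV[OF k]] unfolding above[OF k] high_def by (simp split: if_splits)
    have "{i \<in> ?I. l i \<le> l k} = {1..k}" using l_le k by auto
    \<comment> \<open>For \<open>i = Suc k\<close>, \<open>odd i = s\<close> means
      \<open>odd k \<noteq> s\<close>.\<close>
    moreover have "{i \<in> ?I. u i \<le> l k} = {i \<in> ?I. i \<le> k \<or> odd k \<noteq> s \<and> i = Suc k}"
    proof (rule Collect_cong)
      show "i \<in> ?I \<and> u i \<le> l k \<longleftrightarrow> i \<in> ?I \<and> (i \<le> k \<or> odd k \<noteq> s \<and> i = Suc k)" for i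
        using u_less_l[OF _ k, of i] ul_neq[OF _ k, of i] by (auto simp: le_less)
    qed
    ultimately show "l k = high m s k"
      using rank_id[OF lV[OF k]] unfolding above[OF k] high_def by (simp split: if_splits)
    have "{i \<in> ?I. y (l i) \<le> y (l k)} = {1..k}" using yl_le k by auto
    moreover have "{i \<in> ?I. y (u i) \<le> y (l k)} = {i \<in> ?I. \<not> (k \<le> i \<or> odd k \<noteq> s \<and> k = Suc i)}"
    proof (rule Collect_cong)
      show "i \<in> ?I \<and> y (u i) \<le> y (l k) \<longleftrightarrow> i \<in> ?I \<and> \<not> (k \<le> i \<or> odd k \<noteq> s \<and> k = Suc i)" for i
        using yl_less_yu[OF _ k, of i] by (auto simp: not_less[symmetric])
    qed
    ultimately show "y (l k) = low (\<not> s) k"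
      using rank_y[OF lV[OF k]] unfolding below[OF k] low_def by (simp split: if_splits)
  qed
  have "\<pi> = comb_perm m s"
  proof (rule comb_perm_unique[OF \<pi>])
    fix i assume i: "i \<in> ?I"
    show "inv \<pi> (low s i) = high m (\<not> s) i" using u_low[OF i] yu_high[OF i] by (simp add: y_def)
    show "inv \<pi> (high m s i) = low (\<not> s) i" using l_high[OF i] yl_low[OF i] by (simp add: y_def)
  qed
  then show thesis by (rule that)
qed

section \<open>The equivalence and the count\<close>

text \<open>Combs have the right domination number by \<open>comb_domination_number\<close>.
  Conversely, a connected graph with that number comes from some \<open>comb_perm m s\<close>, whose
  graph is a comb; the two values of \<open>s\<close> give the count.\<close>

theorem theorem7:
  fixes n :: nat
  assumes "n \<ge> 6" and "even n"
  shows "(\<forall>\<pi>. \<pi> permutes {1..n} \<longrightarrow> Digraph_Component.connected (permutation_graph n \<pi>) \<longrightarrow>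
            (domination_number (permutation_graph n \<pi>) = n div 2 \<longleftrightarrow>
             comb (permutation_graph n \<pi>))) \<and>
         card {\<pi>. \<pi> permutes {1..n} \<and> Digraph_Component.connected (permutation_graph n \<pi>) \<and>
                  domination_number (permutation_graph n \<pi>) = n div 2} = 2"
proof -
  obtain m where n: "n = 2 * m" using assms(2) by (elim evenE)
  then have m: "m \<ge> 3" using assms(1) by simp
  have comb_perm: "comb (permutation_graph n (comb_perm m s))"
    "Digraph_Component.connected (permutation_graph n (comb_perm m s))" for s
    unfolding n using m
    by (intro alternating_permutation_graph[OF _ inv_comb_perm_low_high]; simp)+
  have comb_imp: "domination_number (permutation_graph n \<pi>) = n div 2"
    if "comb (permutation_graph n \<pi>)" for \<pi>
    using graph.comb_domination_number[OF graph_permutation_graph that]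
    unfolding verts_permutation_graph by simp
  have imp_comb_perm: "\<exists>s. \<pi> = comb_perm m s"
    if "\<pi> permutes {1..n}" "Digraph_Component.connected (permutation_graph n \<pi>)"
      "domination_number (permutation_graph n \<pi>) = n div 2" for \<pi>
    using domination_number_half_imp_comb_perm[of \<pi> m] that m unfolding n by auto
  have "{\<pi>. \<pi> permutes {1..n} \<and> Digraph_Component.connected (permutation_graph n \<pi>) \<and>
      domination_number (permutation_graph n \<pi>) = n div 2} = {comb_perm m True, comb_perm m False}"
    (is "?P = _")
  proof
    show "?P \<subseteq> {comb_perm m True, comb_perm m False}"
    proof
      fix \<pi> assume "\<pi> \<in> ?P"
      then obtain s where "\<pi> = comb_perm m s" using imp_comb_perm[of \<pi>] by blast
      then show "\<pi> \<in> {comb_perm m True, comb_perm m False}" by (cases s) simp_all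
    qed
    have "comb_perm m s \<in> ?P" for s
      unfolding mem_Collect_eq
      using comb_perm(2) comb_imp[OF comb_perm(1)] permutes_comb_perm[of m s] by (simp add: n)
    then show "{comb_perm m True, comb_perm m False} \<subseteq> ?P" by blast
  qed
  then have "card ?P = 2" using comb_perm_neq[of m] m by simp
  then show ?thesis using comb_imp imp_comb_perm comb_perm by blast
qed

end
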